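(* Let $E$ be a separable Banach space. A sequence $(f_k)$ in $\mathcal L^1_E$ converges strongly to $f_0\in\mathcal L^1_E$ if and only if $(f_k)$ is tight and converges limitedly to $f_0$.
   Context: $(E,\|\cdot\|)$ is a separable Banach space with dual $E^*$ and Borel $\sigma$-algebra $\mathcal B(E)$, and $(\Omega,\mathcal F,\mu)$ is a probability space. $\mathcal L^1_E$ is the (prequotient) space of Bochner $\mu$-integrable functions $f:\Omega\to E$, with seminorm $\|f\|_1=\int_\Omega\|f\|\,d\mu$; convergence in this seminorm is called strong convergence. A subset $L\subset\mathcal L^1_E$ is tight if there exists an $\mathcal F\otimes\mathcal B(E)$-measurable function $h:\Omega\times E\to[0,+\infty]$ such that $\sup_{f\in L}\int_\Omega h(\omega,f(\omega))\,d\mu(\omega)<+\infty$ and such that $\{x\in E: h(\omega,x)\le\beta\}$ is (norm) compact for each $\omega\in\Omega$ and each $\beta\in\mathbb R$. A sequence is tight if its set of terms is tight. Let $\mathcal G$ be the collection of all functions $g:\Omega\times E\to\mathbb R$ such that: (i) $g(\omega,0)=0$ for each $\omega\in\Omega$; (ii) $g(\omega,\cdot)$ is weakly, i.e. $\sigma(E,E^* )$-, continuous for each $\omega\in\Omega$; (iii) there exist $C>0$ and $\phi\in\mathcal L^1_{\mathbb R}$ with $|g(\omega,x)|\le C\|x\|+\phi(\omega)$ for all $\omega\in\Omega$, $x\in E$; (iv) $g(\cdot,f(\cdot))$ is $\mathcal F$-measurable for each $f\in\mathcal L^1_E$. A sequence $(f_k)$ in $\mathcal L^1_E$ converges limitedly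 to $f_0\in\mathcal L^1_E$ if $\lim_k\int_\Omega g(\omega,f_k(\omega)-f_0(\omega))\,d\mu(\omega)=0$ for each $g\in\mathcal G$. *)

theory Defs
  imports "HOL-Probability.Probability"
begin

text \<open>
  Separable Banach spaces are types of class \<open>banach\<close> and \<open>second_countable_topology\<close>: for metric
  spaces, separability and second countability coincide. The probability space is \<open>M\<close>;
  functions on \<open>\<Omega>\<close> are total functions of which only the values on \<open>space M\<close> matter.
\<close>

definition L1_space :: "'w measure \<Rightarrow> ('w \<Rightarrow> 'a::{banach, second_countable_topology}) set"
  where "L1_space M = {f. integrable M f}"

definition L1_seminorm :: "'w measure \<Rightarrow> ('w \<Rightarrow> 'a::{banach, second_countable_topology}) \<Rightarrow> real"
  where "L1_seminorm M f = (\<integral>\<omega>. norm (f \<omega>) \<partial>M)"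

definition strongly_convergent ::
  "'w measure \<Rightarrow> (nat \<Rightarrow> 'w \<Rightarrow> 'a::{banach, second_countable_topology}) \<Rightarrow> ('w \<Rightarrow> 'a) \<Rightarrow> bool"
  where "strongly_convergent M f f0 \<longleftrightarrow>
    (\<lambda>k. L1_seminorm M (\<lambda>\<omega>. f k \<omega> - f0 \<omega>)) \<longlonglongrightarrow> 0"

text \<open>
  The topology \<open>\<sigma>(E, E\<^sup>*)\<close>: the coarsest one making every continuous linear functional
  continuous. The dual is the type \<open>'a \<Rightarrow>\<^sub>L real\<close> of bounded linear functionals.
\<close>

definition weak_topology :: "'a::real_normed_vector topology"
  where "weak_topology =
    topology_generated_by {blinfun_apply \<phi> -` U | (\<phi> :: 'a \<Rightarrow>\<^sub>L real) U. open U}"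

lemma topspace_weak_topology: "topspace (weak_topology :: 'a::real_normed_vector topology) = UNIV"
proof -
  have "(UNIV :: 'a set) = blinfun_apply (0 :: 'a \<Rightarrow>\<^sub>L real) -` UNIV"
    by simp
  then have "(UNIV :: 'a set) \<in> {blinfun_apply \<phi> -` U | (\<phi> :: 'a \<Rightarrow>\<^sub>L real) U. open U}"
    using open_UNIV by blast
  then show ?thesis
    unfolding weak_topology_def topology_generated_by_topspace by blast
qed

text \<open>
  The inequality in the sublevel sets is taken in the extended reals, so that \<open>\<beta>\<close> may be negative.
\<close>

definition tight_L1 ::
  "'w measure \<Rightarrow> ('w \<Rightarrow> 'a::{banach, second_countable_topology}) set \<Rightarrow> bool"
  where "tight_L1 M L \<longleftrightarrow>
    (\<exists>h :: 'w \<Rightarrow> 'a \<Rightarrow> ennreal.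
      (\<lambda>(\<omega>, x). h \<omega> x) \<in> borel_measurable (M \<Otimes>\<^sub>M borel) \<and>
      (SUP f\<in>L. \<integral>\<^sup>+\<omega>. h \<omega> (f \<omega>) \<partial>M) < \<infinity> \<and>
      (\<forall>\<omega>\<in>space M. \<forall>\<beta>::real. compact {x. enn2ereal (h \<omega> x) \<le> ereal \<beta>}))"

definition limited_integrands ::
  "'w measure \<Rightarrow> ('w \<Rightarrow> 'a::{banach, second_countable_topology} \<Rightarrow> real) set"
  where "limited_integrands M =
    {g. (\<forall>\<omega>\<in>space M. g \<omega> 0 = 0) \<and>
        (\<forall>\<omega>\<in>space M. continuous_map weak_topology euclideanreal (g \<omega>)) \<and>
        (\<exists>C>0. \<exists>\<phi> \<in> L1_space M. \<forall>\<omega>\<in>space M. \<forall>x. \<bar>g \<omega> x\<bar> \<le> C * norm x + \<phi> \<omega>) \<and>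
        (\<forall>f \<in> L1_space M. (\<lambda>\<omega>. g \<omega> (f \<omega>)) \<in> borel_measurable M)}"

definition limitedly_convergent ::
  "'w measure \<Rightarrow> (nat \<Rightarrow> 'w \<Rightarrow> 'a::{banach, second_countable_topology}) \<Rightarrow> ('w \<Rightarrow> 'a) \<Rightarrow> bool"
  where "limitedly_convergent M f f0 \<longleftrightarrow>
    (\<forall>g \<in> limited_integrands M. (\<lambda>k. \<integral>\<omega>. g \<omega> (f k \<omega> - f0 \<omega>) \<partial>M) \<longlonglongrightarrow> 0)"

end

theory Submission
  imports Defs
begin

text \<open>
  A strongly convergent sequence converges in measure, so \<open>\<mu> (f\<^sub>k \<notin> K\<^sub>j) \<le> (1/2)\<^sup>j\<close> for all \<open>k\<close> and
  suitable compact sets \<open>K\<^sub>j\<close>; counting the \<open>K\<^sub>j\<close> that a point misses gives a tightness integrand.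

  Conversely, separability and Hahn-Banach give weakly continuous functions
  \<open>p\<^sub>n\<close> (maxima of finitely many \<open>|\<phi>\<^sub>i|\<close>) increasing to the norm. Limited convergence makes
  \<open>p\<^sub>n (f\<^sub>k - f\<^sub>0)\<close> tend to \<open>0\<close> in mean, and tightness upgrades this to
  convergence in measure, hence almost everywhere along subsequences. Instead of proving uniform
  integrability, take \<open>n\<^sub>k\<close> such that \<open>p\<^sub>n\<close> for \<open>n = n\<^sub>k\<close> captures the integral of
  \<open>\<parallel>f\<^sub>k - f\<^sub>0\<parallel>\<close> up to \<open>\<delta>\<close>, and let \<open>N \<omega>\<close> be the largest of the finitely many
  \<open>n\<^sub>k\<close> with \<open>\<parallel>f\<^sub>k \<omega> - f\<^sub>0 \<omega>\<parallel> > \<delta>\<close>. The single integrand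
  \<open>p (N \<omega>)\<close> belongs to the class tested by limited convergence and dominates all these
  captured integrals up to \<open>\<delta>\<close>.
\<close>

section \<open>Hahn-Banach and norming functionals\<close>

text \<open>Positive homogeneity is asked only as an inequality, so that less has to be checked for
  infima of such functionals; \<open>sublinear_scaleR\<close> recovers the equality.\<close>

definition sublinear :: "('a::real_vector \<Rightarrow> real) \<Rightarrow> bool"
  where "sublinear q \<longleftrightarrow>
    (\<forall>x y. q (x + y) \<le> q x + q y) \<and> (\<forall>c\<ge>0. \<forall>x. q (c *\<^sub>R x) \<le> c * q x)"

lemma sublinear_add: "sublinear q \<Longrightarrow> q (x + y) \<le> q x + q y"
  and sublinear_scaleR_le: "sublinear q \<Longrightarrow> 0 \<le> c \<Longrightarrow> q (c *\<^sub>R x) \<le> c * q x"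
  by (simp_all add: sublinear_def)

lemma sublinear_zero:
  assumes "sublinear q" shows "q 0 = 0"
  using sublinear_add[OF assms, of 0 0] sublinear_scaleR_le[OF assms, of 0 0] by simp

lemma sublinear_scaleR:
  assumes q: "sublinear q" and c: "0 \<le> c" shows "q (c *\<^sub>R x) = c * q x"
proof (cases "c = 0")
  case True
  then show ?thesis by (simp add: sublinear_zero[OF q])
next
  case False
  with c have "0 < c" by simp
  have "q x = q ((1 / c) *\<^sub>R (c *\<^sub>R x))" using False by simp
  also have "\<dots> \<le> (1 / c) * q (c *\<^sub>R x)"
    using c by (intro sublinear_scaleR_le[OF q]) simp
  finally have "c * q x \<le> q (c *\<^sub>R x)" using \<open>0 < c\<close> by (simp add: field_simps)
  then show ?thesis using sublinear_scaleR_le[OF q c, of x] by simp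
qed

lemma sublinear_neg: "sublinear q \<Longrightarrow> 0 \<le> q x + q (- x)"
  using sublinear_add[of q x "- x"] by (simp add: sublinear_zero)

text \<open>
  This replaces the one-dimensional extensions in the usual proof of Hahn-Banach: a minimal
  sublinear functional equals its own tilt along every \<open>x\<close>, hence is odd and so linear.
\<close>
lemma sublinear_tilt:
  fixes q :: "'a::real_vector \<Rightarrow> real" and x :: 'a
  assumes q: "sublinear q"
  defines "r \<equiv> \<lambda>y. INF t\<in>{0..}. q (y + t *\<^sub>R x) - t * q x"
  shows "sublinear r" "\<And>y. r y \<le> q y" "r (- x) \<le> - q x"
proof -
  have bdd: "bdd_below ((\<lambda>t. q (y + t *\<^sub>R x) - t * q x) ` {0..})" for y
  \<comment> \<open>The bound is independent of \<open>t\<close>: it comes from splitting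
    \<open>t *\<^sub>R x\<close> into \<open>y + t *\<^sub>R x\<close> and
    \<open>- y\<close>.\<close>
  proof (rule bdd_belowI2[where m = "- q (- y)"])
    fix t :: real assume "t \<in> {0..}"
    then have "t * q x = q ((y + t *\<^sub>R x) + (- y))" by (simp add: sublinear_scaleR[OF q])
    also have "\<dots> \<le> q (y + t *\<^sub>R x) + q (- y)" by (rule sublinear_add[OF q])
    finally show "- q (- y) \<le> q (y + t *\<^sub>R x) - t * q x" by simp
  qed
  have le: "r y \<le> q (y + t *\<^sub>R x) - t * q x" if "0 \<le> t" for y t
    unfolding r_def using that by (intro cINF_lower bdd) simp
  have ge: "c \<le> r y" if "\<And>t. 0 \<le> t \<Longrightarrow> c \<le> q (y + t *\<^sub>R x) - t * q x" for c y
    unfolding r_def using that by (intro cINF_greatest) auto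
  show r_le: "r y \<le> q y" for y using le[of 0 y] by simp
  show "r (- x) \<le> - q x" using le[of 1 "- x"] by (simp add: sublinear_zero[OF q])
  show "sublinear r" unfolding sublinear_def
  proof (intro conjI allI impI)
    fix y z
    \<comment> \<open>A parameter \<open>t\<close> for \<open>y\<close> and a parameter
      \<open>s\<close> for \<open>z\<close> combine to the parameter \<open>t + s\<close> for
      \<open>y + z\<close>. The infimum is taken over \<open>s\<close> first and over
      \<open>t\<close> afterwards.\<close>
    have "r (y + z) - r z \<le> q (y + t *\<^sub>R x) - t * q x" if t: "0 \<le> t" for t
    proof -
      have "r (y + z) - (q (y + t *\<^sub>R x) - t * q x) \<le> q (z + s *\<^sub>R x) - s * q x" if s: "0 \<le> s" for s
      proof -
        have "r (y + z) \<le> q ((y + z) + (t + s) *\<^sub>R x) - (t + s) * q x"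
          using s t by (intro le) simp
        also have "(y + z) + (t + s) *\<^sub>R x = (y + t *\<^sub>R x) + (z + s *\<^sub>R x)"
          by (simp add: algebra_simps)
        also have "q \<dots> \<le> q (y + t *\<^sub>R x) + q (z + s *\<^sub>R x)" by (rule sublinear_add[OF q])
        finally show ?thesis by (simp add: algebra_simps)
      qed
      from ge[OF this] show ?thesis by simp
    qed
    from ge[OF this] show "r (y + z) \<le> r y + r z" by simp
  next
    fix c :: real and y assume c: "0 \<le> c"
    show "r (c *\<^sub>R y) \<le> c * r y"
    proof (cases "c = 0")
      case True
      then show ?thesis using r_le[of 0] by (simp add: sublinear_zero[OF q])
    next
      case False
      with c have "0 < c" by simp
      \<comment> \<open>The parameter \<open>t\<close> for \<open>y\<close> corresponds to
        \<open>c * t\<close> for \<open>c *\<^sub>R y\<close>.\<close>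
      have "r (c *\<^sub>R y) / c \<le> q (y + t *\<^sub>R x) - t * q x" if t: "0 \<le> t" for t
      proof -
        have "r (c *\<^sub>R y) \<le> q (c *\<^sub>R y + (c * t) *\<^sub>R x) - (c * t) * q x"
          using c t by (intro le) simp
        also have "c *\<^sub>R y + (c * t) *\<^sub>R x = c *\<^sub>R (y + t *\<^sub>R x)" by (simp add: algebra_simps)
        also have "q \<dots> = c * q (y + t *\<^sub>R x)" by (rule sublinear_scaleR[OF q c])
        finally show ?thesis using \<open>0 < c\<close> by (simp add: field_simps)
      qed
      from ge[OF this] show ?thesis using \<open>0 < c\<close> by (simp add: field_simps)
    qed
  qed
qed

lemma minimal_sublinear_linear:
  fixes m :: "'a::real_vector \<Rightarrow> real"
  assumes m: "sublinear m" and minimal: "\<And>q. sublinear q \<Longrightarrow> q \<le> m \<Longrightarrow> q = m"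
  shows "linear m"
proof -
  have neg: "m (- x) = - m x" for x
  proof -
    let ?r = "\<lambda>y. INF t\<in>{0..}. m (y + t *\<^sub>R x) - t * m x"
    have r: "?r = m"
      using sublinear_tilt(1,2)[OF m] by (intro minimal) (auto simp: le_fun_def)
    have "?r (- x) \<le> - m x" by (rule sublinear_tilt(3)[OF m])
    with fun_cong[OF r, of "- x"] have "m (- x) \<le> - m x" by (simp only:)
    then show ?thesis using sublinear_neg[OF m, of x] by simp
  qed
  show ?thesis
  proof (rule linearI)
    fix x y
    \<comment> \<open>Since \<open>m\<close> is odd, subadditivity for \<open>x + y\<close> and
      \<open>- y\<close> is the reverse of subadditivity for \<open>x\<close> and
      \<open>y\<close>.\<close>
    have "m x \<le> m (x + y) + m (- y)" using sublinear_add[OF m, of "x + y" "- y"] by simp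
    then show "m (x + y) = m x + m y" using sublinear_add[OF m, of x y] by (simp add: neg)
  next
    fix c x
    show "m (c *\<^sub>R x) = c *\<^sub>R m x"
      using sublinear_scaleR[OF m, of c x] sublinear_scaleR[OF m, of "- c" x] neg[of "c *\<^sub>R x"]
      by (cases "0 \<le> c") auto
  qed
qed

text \<open>Zorn's lemma on the sublinear functionals below \<open>p\<close>: a chain is bounded
  below by its pointwise infimum, and a minimal element is linear by
  \<open>minimal_sublinear_linear\<close>.\<close>

lemma linear_below_sublinear:
  fixes p :: "'a::real_vector \<Rightarrow> real"
  assumes p: "sublinear p"
  obtains l where "linear l" "l \<le> p"
proof -
  define A where "A = {q. sublinear q \<and> q \<le> p}"
  have "\<exists>m\<in>A. \<forall>q\<in>A. q \<le> m \<longrightarrow> q = m"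
  \<comment> \<open>The order is reversed, so the maximal element that Zorn's lemma provides is a
    minimal functional.\<close>
  proof (rule predicate_Zorn)
    show "partial_order_on A (relation_of (\<lambda>a b. b \<le> a) A)"
      by (rule partial_order_on_relation_ofI) auto
  next
    fix C assume C: "C \<in> Chains (relation_of (\<lambda>a b. b \<le> a) A)"
    then have CA: "C \<subseteq> A" and total: "\<And>a b. a \<in> C \<Longrightarrow> b \<in> C \<Longrightarrow> a \<le> b \<or> b \<le> a"
      by (auto simp: Chains_def relation_of_def)
    show "\<exists>u\<in>A. \<forall>a\<in>C. u \<le> a"
    proof (cases "C = {}")
      case True
      with p show ?thesis by (auto simp: A_def)
    next
      case False
      define u where "u y = (INF q\<in>C. q y)" for y
      have bdd: "bdd_below ((\<lambda>q. q y) ` C)" for y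
      proof (rule bdd_belowI2[where m = "- p (- y)"])
        fix q assume "q \<in> C"
        with CA have "sublinear q" "q (- y) \<le> p (- y)" by (auto simp: A_def le_fun_def)
        then show "- p (- y) \<le> q y" using sublinear_neg[of q y] by simp
      qed
      have le: "u y \<le> q y" if "q \<in> C" for q y
        unfolding u_def using that by (intro cINF_lower bdd)
      have ge: "c \<le> u y" if "\<And>q. q \<in> C \<Longrightarrow> c \<le> q y" for c y
        unfolding u_def using that False by (intro cINF_greatest)
      have sub: "sublinear q" if "q \<in> C" for q using that CA by (auto simp: A_def)
      have "sublinear u" unfolding sublinear_def
      proof (intro conjI allI impI)
        fix y z
        have "u (y + z) - u z \<le> a y" if a: "a \<in> C" for a
        proof -
          have "u (y + z) - a y \<le> b z" if b: "b \<in> C" for b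
          proof -
            \<comment> \<open>The chain condition enters here: the smaller of \<open>a\<close> and
              \<open>b\<close> is a single functional whose subadditivity serves both.\<close>
            obtain c where c: "c \<in> C" "c \<le> a" "c \<le> b" using total[OF a b] a b by blast
            have "u (y + z) \<le> c (y + z)" by (rule le[OF c(1)])
            also have "\<dots> \<le> c y + c z" by (rule sublinear_add[OF sub[OF c(1)]])
            also have "\<dots> \<le> a y + b z" using c by (intro add_mono) (auto simp: le_fun_def)
            finally show ?thesis by simp
          qed
          then have "u (y + z) - a y \<le> u z" by (rule ge)
          then show ?thesis by simp
        qed
        then have "u (y + z) - u z \<le> u y" by (rule ge)
        then show "u (y + z) \<le> u y + u z" by simp
      next
        fix c :: real and y assume c: "0 \<le> c"
        show "u (c *\<^sub>R y) \<le> c * u y"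
        proof (cases "c = 0")
          case True
          obtain q where "q \<in> C" using False by blast
          then show ?thesis using True le[of q 0] by (simp add: sublinear_zero[OF sub])
        next
          case False
          with c have "0 < c" by simp
          have "u (c *\<^sub>R y) / c \<le> q y" if "q \<in> C" for q
            using le[OF that, of "c *\<^sub>R y"] sublinear_scaleR[OF sub[OF that] c, of y] \<open>0 < c\<close>
            by (simp add: field_simps)
          then have "u (c *\<^sub>R y) / c \<le> u y" by (rule ge)
          then show ?thesis using \<open>0 < c\<close> by (simp add: field_simps)
        qed
      qed
      moreover have "u \<le> p"
      proof -
        obtain q where "q \<in> C" using False by blast
        then have "u \<le> q" "q \<le> p" using CA le by (auto simp: A_def le_fun_def)
        then show ?thesis by (rule order_trans)
      qed
      ultimately show ?thesis using le by (auto simp: A_def le_fun_def)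
    qed
  qed
  then obtain m where m: "m \<in> A" and min: "\<And>q. q \<in> A \<Longrightarrow> q \<le> m \<Longrightarrow> q = m" by blast
  \<comment> \<open>A functional below \<open>m\<close> is also below \<open>p\<close>, so
    minimality within \<open>A\<close> is minimality among all sublinear functionals.\<close>
  have "linear m"
    by (rule minimal_sublinear_linear) (use m min order_trans[of _ m p] in \<open>auto simp: A_def\<close>)
  with m that show thesis by (auto simp: A_def)
qed

text \<open>Tilting the norm along \<open>x\<close> before taking a linear minorant \<open>l\<close>
  forces \<open>l (- x) \<le> - norm x\<close>, hence \<open>l x = norm x\<close>. The tilt stays
  below the norm, which bounds \<open>l\<close> by 1.\<close>

lemma norming_functional:
  fixes x :: "'a::real_normed_vector"
  obtains \<phi> :: "'a \<Rightarrow>\<^sub>L real" where "norm \<phi> \<le> 1" "blinfun_apply \<phi> x = norm x"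
proof -
  have "sublinear (norm :: 'a \<Rightarrow> real)" by (simp add: sublinear_def norm_triangle_ineq)
  note tilt = sublinear_tilt[OF this]
  obtain l where l: "linear l" and le: "l \<le> (\<lambda>y. INF t\<in>{0..}. norm (y + t *\<^sub>R x) - t * norm x)"
    using linear_below_sublinear[OF tilt(1)] by blast
  have l_le: "l y \<le> norm y" for y using order_trans[OF le_funD[OF le] tilt(2)] .
  have abs_le: "\<bar>l y\<bar> \<le> norm y" for y
    using l_le[of y] l_le[of "- y"] by (simp add: linear_neg[OF l])
  have "l (- x) \<le> - norm x" using order_trans[OF le_funD[OF le] tilt(3)] .
  then have lx: "l x = norm x" using l_le[of x] by (simp add: linear_neg[OF l])
  have bl: "bounded_linear l"
    using l abs_le by (intro bounded_linear_intro[where K = 1]) (auto simp: linear_add linear_cmul)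
  show thesis
  proof (rule that[of "Blinfun l"])
    show "norm (Blinfun l) \<le> 1"
      using abs_le by (intro norm_blinfun_bound) (simp_all add: bounded_linear_Blinfun_apply[OF bl])
    show "blinfun_apply (Blinfun l) x = norm x"
      by (simp add: bounded_linear_Blinfun_apply[OF bl] lx)
  qed
qed

section \<open>Weakly continuous functions\<close>

lemma dense_sequence:
  obtains d :: "nat \<Rightarrow> 'a::{metric_space, second_countable_topology}"
  where "\<And>x e. 0 < e \<Longrightarrow> \<exists>i. dist (d i) x < e"
proof -
  obtain D :: "'a set" where D: "countable D" "\<And>X. open X \<Longrightarrow> X \<noteq> {} \<Longrightarrow> \<exists>d\<in>D. d \<in> X"
    using countable_dense_setE by blast
  then have "D \<noteq> {}" by force
  have "\<exists>i. dist (from_nat_into D i) x < e" if "0 < e" for x e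
  proof -
    have "x \<in> ball x e" using that by simp
    then obtain y where "y \<in> D" "dist x y < e" using D(2)[of "ball x e"] by auto
    then show ?thesis using from_nat_into_surj[OF D(1)] by (metis dist_commute)
  qed
  then show thesis by (rule that)
qed

lemma continuous_map_weak_blinfun_apply:
  "continuous_map weak_topology euclideanreal (blinfun_apply (\<phi> :: 'a::real_normed_vector \<Rightarrow>\<^sub>L real))"
  unfolding continuous_map_def
proof (intro conjI allI impI)
  fix U :: "real set" assume "openin euclideanreal U"
  then have "openin weak_topology (blinfun_apply \<phi> -` U)"
    unfolding weak_topology_def by (intro topology_generated_by_Basis) auto
  also have "blinfun_apply \<phi> -` U = {x \<in> topspace weak_topology. blinfun_apply \<phi> x \<in> U}"
    by (auto simp: topspace_weak_topology)
  finally show "openin weak_topology {x \<in> topspace weak_topology. blinfun_apply \<phi> x \<in> U}" .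
qed simp

lemma openin_weak_imp_open:
  fixes U :: "'a::real_normed_vector set"
  assumes "openin weak_topology U" shows "open U"
proof -
  have "generate_topology_on {blinfun_apply \<phi> -` U | (\<phi> :: 'a \<Rightarrow>\<^sub>L real) U. open U} U"
    using assms unfolding weak_topology_def by (rule openin_topology_generated_by)
  then show ?thesis
    by induction (auto intro!: open_vimage continuous_intros)
qed

text \<open>The weak topology is coarser than the norm topology. Pointwise limits and Borel
  measurability are later derived from norm continuity in this form.\<close>

lemma weakly_continuous_imp_continuous:
  fixes g :: "'a::real_normed_vector \<Rightarrow> real"
  assumes "continuous_map weak_topology euclideanreal g" shows "continuous_on UNIV g"
  unfolding continuous_on_open_vimage[OF open_UNIV]
proof (intro allI impI)
  fix U :: "real set" assume "open U"
  then have "openin weak_topology {x \<in> topspace weak_topology. g x \<in> U}"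
    using assms by (simp add: continuous_map_def)
  then show "open (g -` U \<inter> UNIV)"
    by (auto simp: topspace_weak_topology vimage_def dest: openin_weak_imp_open)
qed

text \<open>The maximum runs over the functionals with index below \<open>n\<close>. Finiteness
  keeps it weakly continuous, which the norm itself is not in infinite dimension.\<close>

primrec max_seminorm :: "(nat \<Rightarrow> 'a::real_normed_vector \<Rightarrow>\<^sub>L real) \<Rightarrow> nat \<Rightarrow> 'a \<Rightarrow> real"
  where "max_seminorm \<phi> 0 x = 0"
  | "max_seminorm \<phi> (Suc n) x = max (max_seminorm \<phi> n x) \<bar>blinfun_apply (\<phi> n) x\<bar>"

text \<open>The functionals norm the points of a dense sequence. Having norm at most 1,
  \<open>\<phi> i\<close> almost attains the norm at every point close to
  \<open>d i\<close>.\<close>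

lemma weakly_continuous_exhaustion_of_norm:
  obtains p :: "nat \<Rightarrow> 'a::{real_normed_vector, second_countable_topology} \<Rightarrow> real"
  where "\<And>n. continuous_map weak_topology euclideanreal (p n)" "\<And>n. p n 0 = 0"
    "\<And>n x. 0 \<le> p n x" "\<And>n x. p n x \<le> norm x" "\<And>x. incseq (\<lambda>n. p n x)"
    "\<And>x. (\<lambda>n. p n x) \<longlonglongrightarrow> norm x"
proof -
  obtain d :: "nat \<Rightarrow> 'a" where d: "\<And>x e. 0 < e \<Longrightarrow> \<exists>i. dist (d i) x < e"
    by (rule dense_sequence) blast
  have "\<exists>\<phi>. \<forall>i. norm (\<phi> i :: 'a \<Rightarrow>\<^sub>L real) \<le> 1 \<and> blinfun_apply (\<phi> i) (d i) = norm (d i)"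
    by (intro choice allI) (metis norming_functional)
  then obtain \<phi> :: "nat \<Rightarrow> 'a \<Rightarrow>\<^sub>L real"
    where norm_\<phi>: "\<And>i. norm (\<phi> i) \<le> 1" and \<phi>_d: "\<And>i. blinfun_apply (\<phi> i) (d i) = norm (d i)"
    by blast
  have abs_le: "\<bar>blinfun_apply (\<phi> i) x\<bar> \<le> norm x" for i x
    using norm_blinfun[of "\<phi> i" x] mult_right_mono[OF norm_\<phi>[of i] norm_ge_zero[of x]] by simp
  let ?p = "max_seminorm \<phi>"
  have le: "?p n x \<le> norm x" for n x by (induction n) (auto simp: abs_le)
  have inc: "incseq (\<lambda>n. ?p n x)" for x by (rule incseq_SucI) simp
  show thesis
  proof (rule that[of ?p])
    fix n x
    show "continuous_map weak_topology euclideanreal (?p n)"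
    proof (induction n)
      case 0
      then show ?case by simp
    next
      case (Suc n)
      then show ?case
        using continuous_map_weak_blinfun_apply[of "\<phi> n"]
        by (simp add: continuous_map_real_max continuous_map_real_abs)
    qed
    show "?p n 0 = 0" by (induction n) auto
    show "0 \<le> ?p n x" by (induction n) auto
    show "?p n x \<le> norm x" by (rule le)
    show "incseq (\<lambda>n. ?p n x)" by (rule inc)
    show "(\<lambda>n. ?p n x) \<longlonglongrightarrow> norm x"
    proof (rule increasing_tendsto)
      fix a assume "a < norm x"
      \<comment> \<open>The distance to \<open>d i\<close> is paid twice, for passing from
        \<open>norm x\<close> to \<open>norm (d i)\<close> and from \<open>\<phi> i (d i)\<close> to
        \<open>\<phi> i x\<close>; hence the half.\<close>
      then obtain i where i: "dist (d i) x < (norm x - a) / 2" using d[of "(norm x - a) / 2" x] by auto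
      have "a < norm x - 2 * norm (x - d i)" using i by (simp add: dist_norm norm_minus_commute)
      also have "\<dots> \<le> norm (d i) - norm (x - d i)" using norm_triangle_ineq2[of x "d i"] by simp
      also have "\<dots> \<le> blinfun_apply (\<phi> i) (d i) - \<bar>blinfun_apply (\<phi> i) (x - d i)\<bar>"
        using abs_le[of i "x - d i"] by (simp add: \<phi>_d)
      also have "\<dots> \<le> \<bar>blinfun_apply (\<phi> i) x\<bar>" by (simp add: blinfun.diff_right)
      \<comment> \<open>\<open>Suc i\<close> is the first index whose maximum includes
        \<open>\<phi> i\<close>.\<close>
      finally have "a < ?p (Suc i) x" by simp
      then show "\<forall>\<^sub>F n in sequentially. a < ?p n x"
        using incseqD[OF inc[of x]] by (intro eventually_sequentiallyI[of "Suc i"]) (meson less_le_trans)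
    qed (simp add: le)
  qed
qed

section \<open>Strong convergence implies limited convergence and tightness\<close>

text \<open>The subsequence principle. It makes almost everywhere convergence usable, since
  convergence in mean yields that only along subsequences.\<close>

lemma tendsto_zero_subseqI:
  fixes a :: "nat \<Rightarrow> real"
  assumes "\<And>r :: nat \<Rightarrow> nat. strict_mono r \<Longrightarrow> \<exists>s :: nat \<Rightarrow> nat. strict_mono s \<and> (\<lambda>n. a (r (s n))) \<longlonglongrightarrow> 0"
  shows "a \<longlonglongrightarrow> 0"
proof (rule ccontr)
  assume "\<not> a \<longlonglongrightarrow> 0"
  then obtain e where e: "0 < e" "\<not> (\<forall>\<^sub>F k in sequentially. dist (a k) 0 < e)"
    by (auto simp: tendsto_iff)
  then have "infinite {k. \<not> dist (a k) 0 < e}"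
    by (simp flip: frequently_cofinite cofinite_eq_sequentially add: not_eventually)
  from infinite_enumerate[OF this]
  obtain r :: "nat \<Rightarrow> nat" where r: "strict_mono r" "\<And>n. \<not> dist (a (r n)) 0 < e" by auto
  from assms[OF r(1)] obtain s where "(\<lambda>n. a (r (s n))) \<longlonglongrightarrow> 0" by auto
  from tendstoD[OF this e(1)] r(2) show False by auto
qed

text \<open>Along an almost everywhere convergent subsequence, continuity at \<open>0\<close> sends
  the integrands to \<open>0\<close>. The growth bound varies with the index, so this is a
  generalised dominated convergence whose bounds converge in mean.\<close>

lemma strongly_convergent_imp_limitedly_convergent:
  fixes f :: "nat \<Rightarrow> 'w \<Rightarrow> 'a::{banach, second_countable_topology}"
  assumes f: "\<And>k. integrable M (f k)" and f0: "integrable M f0"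
    and strong: "strongly_convergent M f f0"
  shows "limitedly_convergent M f f0"
  unfolding limitedly_convergent_def
proof (intro ballI tendsto_zero_subseqI)
  fix g :: "'w \<Rightarrow> 'a \<Rightarrow> real" and r :: "nat \<Rightarrow> nat"
  assume g: "g \<in> limited_integrands M" and r: "strict_mono r"
  define u where "u k \<omega> = f (r k) \<omega> - f0 \<omega>" for k \<omega>
  have u: "integrable M (u k)" for k unfolding u_def by (intro Bochner_Integration.integrable_diff f f0)
  have u_lim: "(\<lambda>k. \<integral>\<omega>. norm (u k \<omega>) \<partial>M) \<longlonglongrightarrow> 0"
    using LIMSEQ_subseq_LIMSEQ[OF strong[unfolded strongly_convergent_def L1_seminorm_def] r]
    by (simp add: u_def o_def)
  obtain s :: "nat \<Rightarrow> nat" where s: "strict_mono s" and ae: "AE \<omega> in M. (\<lambda>n. u (s n) \<omega>) \<longlonglongrightarrow> 0"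
    using tendsto_L1_AE_subseq[OF u u_lim] by blast
  obtain C \<phi> where C: "0 < C" and \<phi>: "integrable M \<phi>"
    and growth: "\<And>\<omega> x. \<omega> \<in> space M \<Longrightarrow> \<bar>g \<omega> x\<bar> \<le> C * norm x + \<phi> \<omega>"
    and g0: "\<And>\<omega>. \<omega> \<in> space M \<Longrightarrow> g \<omega> 0 = 0"
    and g_cont: "\<And>\<omega>. \<omega> \<in> space M \<Longrightarrow> continuous_map weak_topology euclideanreal (g \<omega>)"
    using g by (auto simp: limited_integrands_def L1_space_def)
  have [measurable]: "(\<lambda>\<omega>. g \<omega> (u n \<omega>)) \<in> borel_measurable M" for n
    using g u by (auto simp: limited_integrands_def L1_space_def)
  have [measurable]: "\<phi> \<in> borel_measurable M" using \<phi> by simp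
  have \<phi>_nonneg: "0 \<le> \<phi> \<omega>" if "\<omega> \<in> space M" for \<omega>
    using growth[OF that, of 0] by simp
  have ae_g: "AE \<omega> in M. (\<lambda>n. g \<omega> (u (s n) \<omega>)) \<longlonglongrightarrow> 0"
    using ae AE_space
  proof eventually_elim
    case (elim \<omega>)
    have "isCont (g \<omega>) 0"
      using weakly_continuous_imp_continuous[OF g_cont[OF elim(2)]]
      by (simp add: continuous_on_eq_continuous_at)
    from isCont_tendsto_compose[OF this elim(1)] show ?case by (simp add: g0[OF elim(2)])
  qed
  \<comment> \<open>\<open>\<bar>g \<omega> x\<bar> \<le> C * norm x + min \<bar>g \<omega> x\<bar> (\<phi> \<omega>)\<close>, where only the last term needs dominated convergence.\<close>
  have lim_min: "(\<lambda>n. \<integral>\<omega>. min \<bar>g \<omega> (u (s n) \<omega>)\<bar> (\<phi> \<omega>) \<partial>M) \<longlonglongrightarrow> (\<integral>\<omega>. 0 \<partial>M)"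
  proof (rule integral_dominated_convergence[where w = \<phi>])
    show "AE \<omega> in M. (\<lambda>n. min \<bar>g \<omega> (u (s n) \<omega>)\<bar> (\<phi> \<omega>)) \<longlonglongrightarrow> 0"
      using ae_g AE_space
    proof eventually_elim
      case (elim \<omega>)
      have "(\<lambda>n. min \<bar>g \<omega> (u (s n) \<omega>)\<bar> (\<phi> \<omega>)) \<longlonglongrightarrow> min \<bar>0\<bar> (\<phi> \<omega>)"
        by (intro tendsto_intros elim)
      then show ?case using \<phi>_nonneg[OF elim(2)] by simp
    qed
    show "AE \<omega> in M. norm (min \<bar>g \<omega> (u (s n) \<omega>)\<bar> (\<phi> \<omega>)) \<le> \<phi> \<omega>" for n
      using AE_space by eventually_elim (use \<phi>_nonneg in \<open>auto simp: min_def\<close>)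
  qed (use \<phi> in auto)
  have "(\<lambda>n. C * (\<integral>\<omega>. norm (u (s n) \<omega>) \<partial>M) + (\<integral>\<omega>. min \<bar>g \<omega> (u (s n) \<omega>)\<bar> (\<phi> \<omega>) \<partial>M)) \<longlonglongrightarrow> C * 0 + 0"
    using LIMSEQ_subseq_LIMSEQ[OF u_lim s] lim_min by (intro tendsto_intros) (auto simp: o_def)
  then have lim: "(\<lambda>n. C * (\<integral>\<omega>. norm (u (s n) \<omega>) \<partial>M) + (\<integral>\<omega>. min \<bar>g \<omega> (u (s n) \<omega>)\<bar> (\<phi> \<omega>) \<partial>M)) \<longlonglongrightarrow> 0"
    by simp
  have "(\<lambda>n. \<integral>\<omega>. g \<omega> (u (s n) \<omega>) \<partial>M) \<longlonglongrightarrow> 0"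
  proof (rule Lim_null_comparison[OF always_eventually[OF allI] lim], unfold real_norm_def)
    fix n
    have int_min: "integrable M (\<lambda>\<omega>. min \<bar>g \<omega> (u (s n) \<omega>)\<bar> (\<phi> \<omega>))"
      by (rule Bochner_Integration.integrable_bound[OF \<phi>])
        (use \<phi>_nonneg in \<open>auto intro!: AE_I2 simp: min_def\<close>)
    have int_g: "integrable M (\<lambda>\<omega>. g \<omega> (u (s n) \<omega>))"
      by (rule Bochner_Integration.integrable_bound[of M "\<lambda>\<omega>. C * norm (u (s n) \<omega>) + \<phi> \<omega>"])
        (use growth u \<phi> in \<open>auto intro!: AE_I2 intro: order_trans[OF _ abs_ge_self]\<close>)
    have "\<bar>\<integral>\<omega>. g \<omega> (u (s n) \<omega>) \<partial>M\<bar> \<le> (\<integral>\<omega>. \<bar>g \<omega> (u (s n) \<omega>)\<bar> \<partial>M)"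
      by (rule integral_abs_bound)
    also have "\<dots> \<le> (\<integral>\<omega>. C * norm (u (s n) \<omega>) + min \<bar>g \<omega> (u (s n) \<omega>)\<bar> (\<phi> \<omega>) \<partial>M)"
    proof (rule integral_mono)
      fix \<omega> assume "\<omega> \<in> space M"
      from growth[OF this, of "u (s n) \<omega>"] C
      show "\<bar>g \<omega> (u (s n) \<omega>)\<bar> \<le> C * norm (u (s n) \<omega>) + min \<bar>g \<omega> (u (s n) \<omega>)\<bar> (\<phi> \<omega>)"
        by (simp add: min_def)
    qed (use int_g u int_min in auto)
    also have "\<dots> = C * (\<integral>\<omega>. norm (u (s n) \<omega>) \<partial>M) + (\<integral>\<omega>. min \<bar>g \<omega> (u (s n) \<omega>)\<bar> (\<phi> \<omega>) \<partial>M)"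
      using u int_min by simp
    finally show "\<bar>\<integral>\<omega>. g \<omega> (u (s n) \<omega>) \<partial>M\<bar>
      \<le> C * (\<integral>\<omega>. norm (u (s n) \<omega>) \<partial>M) + (\<integral>\<omega>. min \<bar>g \<omega> (u (s n) \<omega>)\<bar> (\<phi> \<omega>) \<partial>M)" .
  qed
  with s show "\<exists>s. strict_mono s \<and> (\<lambda>n. \<integral>\<omega>. g \<omega> (f (r (s n)) \<omega> - f0 \<omega>) \<partial>M) \<longlonglongrightarrow> 0"
    unfolding u_def by blast
qed

section \<open>Uniform tightness and tightness integrands over a finite measure\<close>

context finite_measure
begin

text \<open>By density the balls cover the whole space, so these sets decrease to the empty set and
  continuity from above applies.\<close>

lemma measure_outside_cballs_tendsto_0:
  fixes Y :: "'a \<Rightarrow> 'b::{second_countable_topology, metric_space}"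
  assumes [measurable]: "Y \<in> borel_measurable M"
    and dense: "\<And>x. \<exists>i. dist (d i) x < e"
  shows "(\<lambda>m. measure M {\<omega>\<in>space M. Y \<omega> \<notin> (\<Union>i<m::nat. cball (d i) e)}) \<longlonglongrightarrow> 0"
proof -
  let ?A = "\<lambda>m. {\<omega>\<in>space M. Y \<omega> \<notin> (\<Union>i<m. cball (d i) e)}"
  have "(\<lambda>m. measure M (?A m)) \<longlonglongrightarrow> measure M (\<Inter>m. ?A m)"
  proof (rule finite_Lim_measure_decseq)
    show "range ?A \<subseteq> sets M" by auto
    show "decseq ?A" by (force simp: decseq_def)
  qed
  also have "(\<Inter>m. ?A m) = {}"
  proof (rule equals0I)
    fix \<omega> assume \<omega>: "\<omega> \<in> (\<Inter>m. ?A m)"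
    obtain i where "dist (d i) (Y \<omega>) < e" using dense by blast
    then have "\<omega> \<notin> ?A (Suc i)" by force
    with \<omega> show False by blast
  qed
  finally show ?thesis by simp
qed

text \<open>Finitely many early \<open>X k\<close> are covered one by one. A late \<open>X k\<close>
  is within \<open>e\<close> of \<open>Y\<close> off a small set, so balls of radius
  \<open>e\<close> that capture \<open>Y\<close> capture \<open>X k\<close> once the radius is
  doubled.\<close>

lemma uniform_cball_cover:
  fixes X :: "nat \<Rightarrow> 'a \<Rightarrow> 'b::{second_countable_topology, metric_space}"
  assumes [measurable]: "\<And>k. X k \<in> borel_measurable M" "Y \<in> borel_measurable M"
    and conv: "(\<lambda>k. measure M {\<omega>\<in>space M. e \<le> dist (X k \<omega>) (Y \<omega>)}) \<longlonglongrightarrow> 0"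
    and dense: "\<And>x e. 0 < e \<Longrightarrow> \<exists>i. dist (d i) x < e" and e: "0 < e" and \<eta>: "0 < \<eta>"
  shows "\<exists>m::nat. \<forall>k. measure M {\<omega>\<in>space M. X k \<omega> \<notin> (\<Union>i<m. cball (d i) (2 * e))} \<le> \<eta>"
proof -
  let ?A = "\<lambda>Z e m. {\<omega>\<in>space M. Z \<omega> \<notin> (\<Union>i<m. cball (d i) e)}"
  obtain k0 where k0: "\<And>k. k0 \<le> k \<Longrightarrow> measure M {\<omega>\<in>space M. e \<le> dist (X k \<omega>) (Y \<omega>)} < \<eta> / 2"
    using order_tendstoD(2)[OF conv, of "\<eta> / 2"] \<eta> by (auto simp: eventually_sequentially)
  have "\<forall>\<^sub>F m in sequentially. \<forall>k\<in>{..<k0}. measure M (?A (X k) (2 * e) m) < \<eta>"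
    using e \<eta>
    by (intro eventually_ball_finite ballI order_tendstoD(2)[OF measure_outside_cballs_tendsto_0] dense) auto
  moreover have "\<forall>\<^sub>F m in sequentially. measure M (?A Y e m) < \<eta> / 2"
    using e \<eta> by (intro order_tendstoD(2)[OF measure_outside_cballs_tendsto_0] dense) auto
  ultimately have "\<forall>\<^sub>F m in sequentially. \<forall>k. measure M (?A (X k) (2 * e) m) \<le> \<eta>"
  proof eventually_elim
    case (elim m)
    show ?case
    proof
      fix k
      show "measure M (?A (X k) (2 * e) m) \<le> \<eta>"
      proof (cases "k < k0")
        case True
        with elim(1) show ?thesis by (auto intro: less_imp_le)
      next
        case False
        let ?B = "{\<omega>\<in>space M. e \<le> dist (X k \<omega>) (Y \<omega>)}"
        have "?A (X k) (2 * e) m \<subseteq> ?A Y e m \<union> ?B"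
        proof
          fix \<omega> assume *: "\<omega> \<in> ?A (X k) (2 * e) m"
          show "\<omega> \<in> ?A Y e m \<union> ?B"
          proof (rule ccontr)
            assume "\<omega> \<notin> ?A Y e m \<union> ?B"
            with * obtain i where "i < m" "dist (d i) (Y \<omega>) \<le> e" "dist (X k \<omega>) (Y \<omega>) < e" by auto
            moreover from this have "dist (d i) (X k \<omega>) \<le> 2 * e"
              using dist_triangle2[of "d i" "X k \<omega>" "Y \<omega>"] by simp
            ultimately show False using * by auto
          qed
        qed
        then have "measure M (?A (X k) (2 * e) m) \<le> measure M (?A Y e m \<union> ?B)"
          by (intro finite_measure_mono) auto
        also have "\<dots> \<le> measure M (?A Y e m) + measure M ?B"
          by (intro measure_Un_le) auto
        also have "\<dots> \<le> \<eta>" using elim(2) k0[of k] False by simp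
        finally show ?thesis .
      qed
    qed
  qed
  then show ?thesis by (auto simp: eventually_sequentially)
qed

text \<open>The compact set is an intersection of finite unions of closed balls with radii tending
  to \<open>0\<close>. It is closed and totally bounded, and completeness makes it compact.\<close>

lemma uniformly_tight_of_convergent_in_measure:
  fixes X :: "nat \<Rightarrow> 'a \<Rightarrow> 'b::{second_countable_topology, complete_space}"
  assumes meas [measurable]: "\<And>k. X k \<in> borel_measurable M" "Y \<in> borel_measurable M"
    and conv: "\<And>e. 0 < e \<Longrightarrow> (\<lambda>k. measure M {\<omega>\<in>space M. e \<le> dist (X k \<omega>) (Y \<omega>)}) \<longlonglongrightarrow> 0"
    and \<eta>: "0 < \<eta>"
  obtains K where "compact K" "\<And>k. measure M {\<omega>\<in>space M. X k \<omega> \<notin> K} \<le> \<eta>"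
proof -
  obtain d :: "nat \<Rightarrow> 'b" where d: "\<And>x e. 0 < e \<Longrightarrow> \<exists>i. dist (d i) x < e"
    by (rule dense_sequence) blast
  define e :: "nat \<Rightarrow> real" where "e n = inverse (Suc n)" for n
  have e: "0 < e n" for n by (simp add: e_def)
  \<comment> \<open>The mass allowed to escape at stage \<open>n\<close> is chosen so that the total
    over all stages is \<eta>.\<close>
  have "\<exists>m. \<forall>n k. measure M {\<omega>\<in>space M. X k \<omega> \<notin> (\<Union>i<m n. cball (d i) (2 * e n))}
      \<le> \<eta> * (1/2) ^ Suc n"
    using \<eta> by (intro choice allI uniform_cball_cover[OF meas conv d] e) auto
  then obtain m :: "nat \<Rightarrow> nat" where
    m: "\<And>n k. measure M {\<omega>\<in>space M. X k \<omega> \<notin> (\<Union>i<m n. cball (d i) (2 * e n))} \<le> \<eta> * (1/2) ^ Suc n"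
    by blast
  define F where "F n = (\<Union>i<m n. cball (d i) (2 * e n))" for n
  have F_closed: "closed (F n)" for n unfolding F_def by (intro closed_UN) auto
  then have [measurable]: "F n \<in> sets borel" for n by (rule borel_closed)
  show thesis
  proof (rule that[of "\<Inter>n. F n"])
    show "compact (\<Inter>n. F n)"
      unfolding compact_eq_totally_bounded
    proof (intro conjI allI impI)
      show "Topological_Spaces.complete (\<Inter>n. F n)" using F_closed by (simp add: complete_eq_closed closed_INT)
    next
      fix \<epsilon> :: real assume "0 < \<epsilon>"
      \<comment> \<open>The half absorbs the factor 2 in the radii of the balls forming
        \<open>F n\<close>.\<close>
      then obtain n where n: "inverse (Suc n) < \<epsilon> / 2" using reals_Archimedean[of "\<epsilon> / 2"] by auto
      have "(\<Inter>n. F n) \<subseteq> F n" by blast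
      also have "F n \<subseteq> (\<Union>x\<in>d ` {..<m n}. ball x \<epsilon>)"
        using n by (force simp: F_def e_def)
      finally show "\<exists>k. finite k \<and> (\<Inter>n. F n) \<subseteq> (\<Union>x\<in>k. ball x \<epsilon>)" by blast
    qed
    fix k
    let ?A = "\<lambda>n. {\<omega>\<in>space M. X k \<omega> \<notin> F n}"
    have bound: "measure M (?A n) \<le> \<eta> * (1/2) ^ Suc n" for n using m[of k n] by (simp add: F_def)
    have sums: "(\<lambda>n. \<eta> * (1/2) ^ Suc n) sums (\<eta> * 1)" by (intro sums_mult power_half_series)
    have summ: "summable (\<lambda>n. measure M (?A n))"
      using bound by (intro summable_comparison_test'[OF sums_summable[OF sums], of 0]) simp
    have "{\<omega>\<in>space M. X k \<omega> \<notin> (\<Inter>n. F n)} = (\<Union>n. ?A n)" by auto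
    also have "measure M \<dots> \<le> (\<Sum>n. measure M (?A n))"
      by (intro finite_measure_subadditive_countably summ) auto
    also have "\<dots> \<le> \<eta>"
      using suminf_le[OF bound summ sums_summable[OF sums]] sums_unique[OF sums] by simp
    finally show "measure M {\<omega>\<in>space M. X k \<omega> \<notin> (\<Inter>n. F n)} \<le> \<eta>" .
  qed
qed

lemma tight_L1_of_uniformly_tight:
  fixes X :: "nat \<Rightarrow> 'a \<Rightarrow> 'b::{banach, second_countable_topology}"
  assumes [measurable]: "\<And>k. X k \<in> borel_measurable M"
    and K: "\<And>j. compact (K j)" and bound: "\<And>j k. measure M {\<omega>\<in>space M. X k \<omega> \<notin> K j} \<le> (1/2) ^ j"
  shows "tight_L1 M (range X)"
proof -
  \<comment> \<open>Once the sets increase, the number of sets that a point misses determines which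
    ones it misses, so the sublevel sets of \<open>h\<close> are themselves sets
    \<open>L j\<close>.\<close>
  define L where "L j = (\<Union>i\<le>j. K i)" for j
  have L: "compact (L j)" for j unfolding L_def using K by (intro compact_UN) auto
  have L_mono: "L i \<subseteq> L j" if "i \<le> j" for i j using that by (force simp: L_def)
  have [measurable]: "L j \<in> sets borel" "K j \<in> sets borel" for j using L K by (auto intro: borel_compact)
  define h :: "'b \<Rightarrow> ennreal" where "h x = (\<Sum>j. indicator (- L j) x)" for x
  have [measurable]: "h \<in> borel_measurable borel" unfolding h_def by measurable
  have "(\<integral>\<^sup>+\<omega>. h (X k \<omega>) \<partial>M) \<le> 2" for k
  proof -
    have "(\<integral>\<^sup>+\<omega>. h (X k \<omega>) \<partial>M) = (\<Sum>j. \<integral>\<^sup>+\<omega>. indicator (- L j) (X k \<omega>) \<partial>M)"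
      unfolding h_def by (intro nn_integral_suminf) measurable
    also have "\<dots> \<le> (\<Sum>j. ennreal ((1/2) ^ j))"
    proof (intro suminf_le summableI)
      fix j
      have "(\<integral>\<^sup>+\<omega>. indicator (- L j) (X k \<omega>) \<partial>M) = (\<integral>\<^sup>+\<omega>. indicator {\<omega>\<in>space M. X k \<omega> \<notin> L j} \<omega> \<partial>M)"
        by (intro nn_integral_cong) (auto simp: indicator_def)
      also have "\<dots> = emeasure M {\<omega>\<in>space M. X k \<omega> \<notin> L j}" by (intro nn_integral_indicator) measurable
      also have "\<dots> \<le> emeasure M {\<omega>\<in>space M. X k \<omega> \<notin> K j}"
        by (intro emeasure_mono) (auto simp: L_def)
      also have "\<dots> \<le> ennreal ((1/2) ^ j)"
        using bound[of k j] by (simp add: emeasure_eq_measure ennreal_leI)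
      finally show "(\<integral>\<^sup>+\<omega>. indicator (- L j) (X k \<omega>) \<partial>M) \<le> ennreal ((1/2) ^ j)" .
    qed
    also have "\<dots> = ennreal (\<Sum>j. (1/2) ^ j)"
      by (intro suminf_ennreal2) (auto intro: summable_geometric)
    also have "\<dots> = 2" by (subst suminf_geometric) auto
    finally show ?thesis .
  qed
  then have "(SUP g\<in>range X. \<integral>\<^sup>+\<omega>. h (g \<omega>) \<partial>M) \<le> 2" by (intro SUP_least) auto
  then have fin: "(SUP g\<in>range X. \<integral>\<^sup>+\<omega>. h (g \<omega>) \<partial>M) < \<infinity>" by (rule le_less_trans) simp
  \<comment> \<open>With \<open>m\<close> the integer part of \<beta>, a point of \<open>L m\<close>
    misses at most the \<open>m\<close> sets \<open>L 0, ..., L (m - 1)\<close>, while a point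
    outside \<open>L m\<close> misses at least \<open>m + 1 > \<beta>\<close> sets.\<close>
  have sublevel: "{x. enn2ereal (h x) \<le> ereal \<beta>} = L (nat \<lfloor>\<beta>\<rfloor>)" if \<beta>: "0 \<le> \<beta>" for \<beta>
  proof (intro set_eqI iffI; unfold mem_Collect_eq)
    let ?m = "nat \<lfloor>\<beta>\<rfloor>"
    fix x
    {
      assume x: "x \<in> L ?m"
      have "h x = (\<Sum>j<?m. indicator (- L j) x)"
        unfolding h_def
      proof (rule suminf_finite)
        fix j assume "j \<notin> {..<?m}"
        then have "x \<in> L j" using L_mono[of ?m j] x by auto
        then show "indicator (- L j) x = (0::ennreal)" by simp
      qed simp
      also have "\<dots> \<le> (\<Sum>j<?m. 1)" by (intro sum_mono) (auto simp: indicator_def)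
      also have "\<dots> = ennreal ?m" by (simp add: ennreal_of_nat_eq_real_of_nat)
      also have "\<dots> \<le> ennreal \<beta>" using \<beta> by (intro ennreal_leI) (auto simp: of_nat_floor)
      finally have "enn2ereal (h x) \<le> enn2ereal (ennreal \<beta>)" by (simp add: less_eq_ennreal.rep_eq)
      then show "enn2ereal (h x) \<le> ereal \<beta>" using \<beta> by (simp add: enn2ereal_ennreal)
    next
      assume "enn2ereal (h x) \<le> ereal \<beta>"
      then have hx: "h x \<le> ennreal \<beta>" using \<beta> by (simp add: less_eq_ennreal.rep_eq enn2ereal_ennreal)
      show "x \<in> L ?m"
      proof (rule ccontr)
        assume x: "x \<notin> L ?m"
        have "ennreal (Suc ?m) = (\<Sum>j<Suc ?m. 1)" by (simp add: ennreal_of_nat_eq_real_of_nat)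
        also have "\<dots> = (\<Sum>j<Suc ?m. indicator (- L j) x)"
        proof (rule sum.cong)
          fix j assume "j \<in> {..<Suc ?m}"
          then have "x \<notin> L j" using L_mono[of j ?m] x by auto
          then show "1 = (indicator (- L j) x :: ennreal)" by simp
        qed simp
        also have "\<dots> \<le> h x" unfolding h_def by (intro sum_le_suminf) auto
        also have "\<dots> \<le> ennreal \<beta>" by (rule hx)
        finally have "real (Suc ?m) \<le> \<beta>" using \<beta> by (subst (asm) ennreal_le_iff) auto
        then show False using \<beta> by linarith
      qed
    }
  qed
  have "\<forall>\<beta>::real. compact {x. enn2ereal (h x) \<le> ereal \<beta>}"
  proof
    fix \<beta> :: real
    show "compact {x. enn2ereal (h x) \<le> ereal \<beta>}"
    proof (cases "0 \<le> \<beta>")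
      case True
      then show ?thesis using sublevel L by simp
    next
      case False
      then have "{x. enn2ereal (h x) \<le> ereal \<beta>} = {}"
        using enn2ereal_nonneg[THEN order_trans, of _ "ereal \<beta>"] by auto
      then show ?thesis by simp
    qed
  qed
  moreover have "(\<lambda>(\<omega>, x). h x) \<in> borel_measurable (M \<Otimes>\<^sub>M borel)" by measurable
  ultimately show ?thesis
    unfolding tight_L1_def by (intro exI[of _ "\<lambda>\<omega>. h"] conjI fin ballI)
qed

end

lemma (in prob_space) strongly_convergent_imp_tight_L1:
  fixes f :: "nat \<Rightarrow> 'a \<Rightarrow> 'b::{banach, second_countable_topology}"
  assumes f: "\<And>k. integrable M (f k)" and f0: "integrable M f0"
    and strong: "strongly_convergent M f f0"
  shows "tight_L1 M (range f)"
proof -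
  have [measurable]: "f k \<in> borel_measurable M" "f0 \<in> borel_measurable M" for k using f f0 by auto
  \<comment> \<open>Convergence in measure, by Markov's inequality.\<close>
  have conv: "(\<lambda>k. measure M {\<omega>\<in>space M. e \<le> dist (f k \<omega>) (f0 \<omega>)}) \<longlonglongrightarrow> 0" if e: "0 < e" for e
  proof (rule Lim_null_comparison)
    have "(\<lambda>k. (\<integral>\<omega>. norm (f k \<omega> - f0 \<omega>) \<partial>M) / e) \<longlonglongrightarrow> 0 / e"
      using strong e unfolding strongly_convergent_def L1_seminorm_def by (intro tendsto_intros) auto
    then show "(\<lambda>k. (\<integral>\<omega>. norm (f k \<omega> - f0 \<omega>) \<partial>M) / e) \<longlonglongrightarrow> 0" by simp
    show "\<forall>\<^sub>F k in sequentially. norm (measure M {\<omega>\<in>space M. e \<le> dist (f k \<omega>) (f0 \<omega>)})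
      \<le> (\<integral>\<omega>. norm (f k \<omega> - f0 \<omega>) \<partial>M) / e"
      using f f0 e unfolding dist_norm
      by (intro always_eventually allI)
        (auto intro!: integral_Markov_inequality_measure[where A = "space M"])
  qed
  have "\<exists>K. \<forall>j. compact (K j) \<and> (\<forall>k. measure M {\<omega>\<in>space M. f k \<omega> \<notin> K j} \<le> (1/2) ^ j)"
  proof (intro choice allI)
    fix j :: nat
    obtain K where "compact K" "\<And>k. measure M {\<omega>\<in>space M. f k \<omega> \<notin> K} \<le> (1/2) ^ j"
      by (rule uniformly_tight_of_convergent_in_measure[of f f0 "(1/2) ^ j"]) (use conv in auto)
    then show "\<exists>K. compact K \<and> (\<forall>k. measure M {\<omega>\<in>space M. f k \<omega> \<notin> K} \<le> (1/2) ^ j)" by blast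
  qed
  then obtain K where "\<And>j. compact (K j)" "\<And>j k. measure M {\<omega>\<in>space M. f k \<omega> \<notin> K j} \<le> (1/2) ^ j"
    by blast
  then show ?thesis by (intro tight_L1_of_uniformly_tight[of f K]) auto
qed

section \<open>Tightness and limited convergence imply strong convergence\<close>

text \<open>The index may depend measurably on \<omega>: it takes countably many values, which
  preserves measurability, and the bound by the norm is uniform in the index.\<close>

lemma limited_integrands_variable_index:
  fixes p :: "nat \<Rightarrow> 'a::{banach, second_countable_topology} \<Rightarrow> real"
  assumes cont: "\<And>n. continuous_map weak_topology euclideanreal (p n)" and zero: "\<And>n. p n 0 = 0"
    and nonneg: "\<And>n x. 0 \<le> p n x" and le: "\<And>n x. p n x \<le> norm x"
    and N: "N \<in> measurable M (count_space UNIV)"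
  shows "(\<lambda>\<omega>. p (N \<omega>)) \<in> limited_integrands M"
proof -
  have [measurable]: "p n \<in> borel_measurable borel" for n
    by (intro borel_measurable_continuous_onI weakly_continuous_imp_continuous cont)
  have "(\<lambda>\<omega>. p (N \<omega>) (f \<omega>)) \<in> borel_measurable M" if "f \<in> L1_space M" for f
  proof (rule measurable_compose_countable[OF _ N])
    have [measurable]: "f \<in> borel_measurable M" using that by (auto simp: L1_space_def)
    show "(\<lambda>\<omega>. p n (f \<omega>)) \<in> borel_measurable M" for n by measurable
  qed
  moreover have "\<exists>C>0. \<exists>\<phi>\<in>L1_space M. \<forall>\<omega>\<in>space M. \<forall>x. \<bar>p (N \<omega>) x\<bar> \<le> C * norm x + \<phi> \<omega>"
    by (intro exI[of _ 1] conjI bexI[of _ "\<lambda>_. 0"]) (auto simp: L1_space_def nonneg le)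
  ultimately show ?thesis using cont zero by (auto simp: limited_integrands_def)
qed

text \<open>If \<open>l\<close> is a cluster point of the terms lying in \<open>K\<close>,
  continuity gives \<open>p n (l - c) = 0\<close> for every \<open>n\<close>. As these values tend
  to \<open>norm (l - c)\<close>, the only possible cluster point is \<open>c\<close>.\<close>

lemma tendsto_zero_on_compact:
  fixes p :: "nat \<Rightarrow> 'a::real_normed_vector \<Rightarrow> real"
  assumes K: "compact K" and cont: "\<And>n. continuous_on UNIV (p n)"
    and lim: "\<And>x. (\<lambda>n. p n x) \<longlonglongrightarrow> norm x"
    and y: "\<And>n. (\<lambda>k. p n (y k - c)) \<longlonglongrightarrow> 0"
  shows "(\<lambda>k. if y k \<in> K then norm (y k - c) else 0) \<longlonglongrightarrow> 0"
proof (rule tendsto_zero_subseqI)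
  fix r :: "nat \<Rightarrow> nat" assume r: "strict_mono r"
  let ?a = "\<lambda>k. if y k \<in> K then norm (y k - c) else 0"
  show "\<exists>s. strict_mono s \<and> (\<lambda>k. ?a (r (s k))) \<longlonglongrightarrow> 0"
  proof (cases "finite {k. y (r k) \<in> K}")
    case True
    then have "\<forall>\<^sub>F k in sequentially. ?a (r k) = 0"
      unfolding cofinite_eq_sequentially[symmetric] eventually_cofinite
      by (rule rev_finite_subset) auto
    then have "(\<lambda>k. ?a (r k)) \<longlonglongrightarrow> 0" by (rule tendsto_eventually)
    then show ?thesis by (intro exI[of _ "\<lambda>k. k"]) (simp add: strict_mono_def)
  next
    case False
    from infinite_enumerate[OF this]
    obtain s :: "nat \<Rightarrow> nat" where s: "strict_mono s" "\<And>k. y (r (s k)) \<in> K" by auto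
    have "seq_compact K" using K by (simp add: compact_imp_seq_compact)
    then obtain l t where t: "strict_mono t" and l: "(\<lambda>k. y (r (s (t k)))) \<longlonglongrightarrow> l"
      using s(2) seq_compactE[of K "\<lambda>k. y (r (s k))"] unfolding o_def by blast
    define q where "q = r \<circ> s \<circ> t"
    have q: "strict_mono q" unfolding q_def by (intro strict_mono_o r s t)
    have yq: "(\<lambda>k. y (q k)) \<longlonglongrightarrow> l" using l by (simp add: q_def)
    have "p n (l - c) = 0" for n
    proof (rule LIMSEQ_unique)
      have "isCont (p n) (l - c)" using cont[of n] by (simp add: continuous_on_eq_continuous_at)
      then show "(\<lambda>k. p n (y (q k) - c)) \<longlonglongrightarrow> p n (l - c)"
        by (rule isCont_tendsto_compose) (intro tendsto_intros yq)
      show "(\<lambda>k. p n (y (q k) - c)) \<longlonglongrightarrow> 0"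
        using LIMSEQ_subseq_LIMSEQ[OF y q] by (simp add: o_def)
    qed
    then have "l = c" using lim[of "l - c"] by (simp add: LIMSEQ_const_iff)
    then have "(\<lambda>k. norm (y (q k) - c)) \<longlonglongrightarrow> 0" using yq by (simp add: LIM_zero tendsto_norm_zero)
    then have "(\<lambda>k. ?a (r ((s \<circ> t) k))) \<longlonglongrightarrow> 0" using s(2) by (simp add: q_def)
    then show ?thesis using strict_mono_o[OF s(1) t] by blast
  qed
qed

text \<open>Where \<open>h\<close> exceeds a large \<beta> the measure is small by Markov's
  inequality. Elsewhere \<open>f k \<omega>\<close> lies in a compact set depending on \<omega> but
  not on \<open>k\<close>, so \<open>tendsto_zero_on_compact\<close> applies pointwise; truncation
  at 1 supplies a dominating constant.\<close>

lemma (in finite_measure) tight_L1_truncated_integral_tendsto_0: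
  fixes f :: "nat \<Rightarrow> 'a \<Rightarrow> 'b::{banach, second_countable_topology}"
  assumes meas [measurable]: "\<And>k. f k \<in> borel_measurable M" "f0 \<in> borel_measurable M"
    and tight: "tight_L1 M (range f)"
    and cont: "\<And>n. continuous_on UNIV (p n)" and lim: "\<And>x. (\<lambda>n. p n x) \<longlonglongrightarrow> norm x"
    and conv: "AE \<omega> in M. \<forall>n. (\<lambda>k. p n (f k \<omega> - f0 \<omega>)) \<longlonglongrightarrow> 0"
  shows "(\<lambda>k. \<integral>\<omega>. min 1 (norm (f k \<omega> - f0 \<omega>)) \<partial>M) \<longlonglongrightarrow> 0"
proof -
  obtain h :: "'a \<Rightarrow> 'b \<Rightarrow> ennreal" where
    h_meas: "(\<lambda>(\<omega>, x). h \<omega> x) \<in> borel_measurable (M \<Otimes>\<^sub>M borel)"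
    and h_fin: "(SUP g\<in>range f. \<integral>\<^sup>+\<omega>. h \<omega> (g \<omega>) \<partial>M) < \<infinity>"
    and h_compact: "\<And>\<omega> \<beta>. \<omega> \<in> space M \<Longrightarrow> compact {x. enn2ereal (h \<omega> x) \<le> ereal \<beta>}"
    using tight unfolding tight_L1_def by blast
  have [measurable]: "(\<lambda>\<omega>. h \<omega> (f k \<omega>)) \<in> borel_measurable M" for k
    using measurable_compose[OF _ h_meas, of "\<lambda>\<omega>. (\<omega>, f k \<omega>)" M] by simp
  define S where "S = enn2real (SUP g\<in>range f. \<integral>\<^sup>+\<omega>. h \<omega> (g \<omega>) \<partial>M)"
  have S: "(\<integral>\<^sup>+\<omega>. h \<omega> (f k \<omega>) \<partial>M) \<le> ennreal S" for k
    using h_fin unfolding S_def by (subst ennreal_enn2real) (auto intro: SUP_upper)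
  have "0 \<le> S" by (simp add: S_def)
  show ?thesis
  proof (rule order_tendstoI)
    fix e :: real assume "0 < e"
    \<comment> \<open>Chosen so that Markov's bound \<open>S / \<beta>\<close> is below
      \<open>e / 2\<close>; adding 1 keeps \<beta> positive when \<open>S = 0\<close>.\<close>
    define \<beta> where "\<beta> = 2 * (S + 1) / e"
    have \<beta>: "0 < \<beta>" using \<open>0 < e\<close> \<open>0 \<le> S\<close> by (simp add: \<beta>_def)
    let ?A = "\<lambda>k. {\<omega>\<in>space M. \<not> h \<omega> (f k \<omega>) \<le> ennreal \<beta>}"
    let ?b = "\<lambda>k \<omega>. if h \<omega> (f k \<omega>) \<le> ennreal \<beta> then min 1 (norm (f k \<omega> - f0 \<omega>)) else 0"
    have A: "measure M (?A k) < e / 2" for k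
    proof -
      have "emeasure M (?A k) = (\<integral>\<^sup>+\<omega>. indicator (?A k) \<omega> \<partial>M)" by simp
      also have "\<dots> \<le> (\<integral>\<^sup>+\<omega>. ennreal (1 / \<beta>) * h \<omega> (f k \<omega>) \<partial>M)"
      proof (rule nn_integral_mono)
        fix \<omega>
        have "ennreal (1 / \<beta>) * ennreal \<beta> = 1" using \<beta> by (simp flip: ennreal_mult)
        then have "1 \<le> ennreal (1 / \<beta>) * h \<omega> (f k \<omega>)" if "ennreal \<beta> \<le> h \<omega> (f k \<omega>)"
          using mult_left_mono[OF that, of "ennreal (1 / \<beta>)"] by simp
        then show "indicator (?A k) \<omega> \<le> ennreal (1 / \<beta>) * h \<omega> (f k \<omega>)"
          by (auto simp: indicator_def not_le)
      qed
      also have "\<dots> = ennreal (1 / \<beta>) * (\<integral>\<^sup>+\<omega>. h \<omega> (f k \<omega>) \<partial>M)"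
        by (intro nn_integral_cmult) measurable
      also have "\<dots> \<le> ennreal (1 / \<beta>) * ennreal S" by (intro mult_left_mono S) simp
      also have "\<dots> = ennreal (S / \<beta>)" using \<beta> \<open>0 \<le> S\<close> by (simp flip: ennreal_mult)
      finally have "measure M (?A k) \<le> S / \<beta>"
        using \<beta> \<open>0 \<le> S\<close> by (simp add: emeasure_eq_measure)
      also have "\<dots> < e / 2" using \<open>0 < e\<close> \<open>0 \<le> S\<close> by (simp add: \<beta>_def field_simps)
      finally show ?thesis .
    qed
    have "(\<lambda>k. \<integral>\<omega>. ?b k \<omega> \<partial>M) \<longlonglongrightarrow> (\<integral>\<omega>. 0 \<partial>M)"
    proof (rule integral_dominated_convergence[where w = "\<lambda>_. 1"])
      show "AE \<omega> in M. (\<lambda>k. ?b k \<omega>) \<longlonglongrightarrow> 0"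
        using conv AE_space
      proof eventually_elim
        case (elim \<omega>)
        let ?K = "{x. enn2ereal (h \<omega> x) \<le> ereal \<beta>}"
        have mem: "f k \<omega> \<in> ?K \<longleftrightarrow> h \<omega> (f k \<omega>) \<le> ennreal \<beta>" for k
          using \<beta> by (simp add: less_eq_ennreal.rep_eq enn2ereal_ennreal)
        have "(\<lambda>k. if f k \<omega> \<in> ?K then norm (f k \<omega> - f0 \<omega>) else 0) \<longlonglongrightarrow> 0"
          by (rule tendsto_zero_on_compact[OF h_compact[OF elim(2)] cont lim]) (use elim(1) in blast)
        then have "(\<lambda>k. if h \<omega> (f k \<omega>) \<le> ennreal \<beta> then norm (f k \<omega> - f0 \<omega>) else 0) \<longlonglongrightarrow> 0"
          by (simp only: mem)
        then show ?case by (rule Lim_null_comparison[rotated]) simp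
      qed
    qed auto
    then have "\<forall>\<^sub>F k in sequentially. (\<integral>\<omega>. ?b k \<omega> \<partial>M) < e / 2"
      using \<open>0 < e\<close> by (intro order_tendstoD(2)) auto
    then show "\<forall>\<^sub>F k in sequentially. (\<integral>\<omega>. min 1 (norm (f k \<omega> - f0 \<omega>)) \<partial>M) < e"
    proof eventually_elim
      case (elim k)
      have int_b: "integrable M (?b k)" by (rule integrable_const_bound[of _ 1]) auto
      have "(\<integral>\<omega>. min 1 (norm (f k \<omega> - f0 \<omega>)) \<partial>M) \<le> (\<integral>\<omega>. indicator (?A k) \<omega> + ?b k \<omega> \<partial>M)"
      proof (rule integral_mono)
        show "integrable M (\<lambda>\<omega>. min 1 (norm (f k \<omega> - f0 \<omega>)))"
          by (rule integrable_const_bound[of _ 1]) auto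
        show "integrable M (\<lambda>\<omega>. indicator (?A k) \<omega> + ?b k \<omega>)"
          by (intro Bochner_Integration.integrable_add int_b) (simp add: emeasure_eq_measure)
      qed (auto simp: indicator_def)
      also have "\<dots> = measure M (?A k) + (\<integral>\<omega>. ?b k \<omega> \<partial>M)"
        by (subst Bochner_Integration.integral_add) (auto simp: int_b emeasure_eq_measure)
      also have "\<dots> < e" using A[of k] elim by simp
      finally show ?case .
    qed
  next
    fix a :: real assume "a < 0"
    moreover have "0 \<le> (\<integral>\<omega>. min 1 (norm (f k \<omega> - f0 \<omega>)) \<partial>M)" for k
      by (intro integral_nonneg_AE) auto
    ultimately show "\<forall>\<^sub>F k in sequentially. a < (\<integral>\<omega>. min 1 (norm (f k \<omega> - f0 \<omega>)) \<partial>M)"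
      by (intro always_eventually allI) (rule less_le_trans)
  qed
qed

text \<open>One subsequence must serve all \<open>n\<close>. A diagonal choice makes
  \<open>p n (u (s n) \<omega>)\<close> tend to \<open>0\<close> in mean, hence almost everywhere
  along a further subsequence, and monotonicity in the index passes this on to each fixed
  \<open>n\<close>.\<close>

lemma AE_tendsto_0_diagonal_subseq:
  fixes u :: "nat \<Rightarrow> 'w \<Rightarrow> 'a::{banach, second_countable_topology}"
  assumes int: "\<And>n k. integrable M (\<lambda>\<omega>. p n (u k \<omega>))"
    and nonneg: "\<And>n x. 0 \<le> (p n x :: real)" and inc: "\<And>x. incseq (\<lambda>n. p n x)"
    and lim: "\<And>n. (\<lambda>k. \<integral>\<omega>. p n (u k \<omega>) \<partial>M) \<longlonglongrightarrow> 0"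
  obtains s :: "nat \<Rightarrow> nat" where "strict_mono s" "AE \<omega> in M. \<forall>n. (\<lambda>k. p n (u (s k) \<omega>)) \<longlonglongrightarrow> 0"
proof -
  have "\<exists>K. \<forall>n. \<forall>k\<ge>K n. (\<integral>\<omega>. p n (u k \<omega>) \<partial>M) < inverse (real (Suc n))"
    by (intro choice allI order_tendstoD(2)[OF lim, unfolded eventually_sequentially]) simp
  then obtain K where K: "\<And>n k. K n \<le> k \<Longrightarrow> (\<integral>\<omega>. p n (u k \<omega>) \<partial>M) < inverse (real (Suc n))"
    by blast
  \<comment> \<open>The sum dominates \<open>K n\<close>, and the successors make it strictly
    increasing.\<close>
  define s where "s n = (\<Sum>i\<le>n. Suc (K i))" for n
  have s: "strict_mono s" by (simp add: strict_mono_Suc_iff s_def)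
  have "K n \<le> s n" for n by (cases n) (simp_all add: s_def)
  then have bound: "(\<integral>\<omega>. p n (u (s n) \<omega>) \<partial>M) \<le> inverse (real (Suc n))" for n
    using K less_imp_le by blast
  have "(\<lambda>n. \<integral>\<omega>. norm (p n (u (s n) \<omega>)) \<partial>M) \<longlonglongrightarrow> 0"
  proof (rule Lim_null_comparison[OF always_eventually[OF allI] LIMSEQ_inverse_real_of_nat])
    show "norm (\<integral>\<omega>. norm (p n (u (s n) \<omega>)) \<partial>M) \<le> inverse (real (Suc n))" for n
      using bound[of n] by (simp add: nonneg)
  qed
  from tendsto_L1_AE_subseq[OF int this] obtain t :: "nat \<Rightarrow> nat" where t: "strict_mono t"
    and ae: "AE \<omega> in M. (\<lambda>n. p (t n) (u (s (t n)) \<omega>)) \<longlonglongrightarrow> 0" by blast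
  from ae have "AE \<omega> in M. \<forall>n. (\<lambda>k. p n (u ((s \<circ> t) k) \<omega>)) \<longlonglongrightarrow> 0"
  proof eventually_elim
    case (elim \<omega>)
    show ?case
    proof
      fix n
      \<comment> \<open>\<open>k \<le> t k\<close> for a strictly increasing \<open>t\<close>, so
        every fixed \<open>n\<close> is eventually overtaken.\<close>
      have "p n x \<le> p (t k) x" if "n \<le> k" for k x
        using incseqD[OF inc] that strict_mono_imp_increasing[OF t, of k] by (meson order_trans)
      then show "(\<lambda>k. p n (u ((s \<circ> t) k) \<omega>)) \<longlonglongrightarrow> 0"
        by (intro Lim_null_comparison[OF eventually_sequentiallyI[of n] elim]) (simp add: nonneg)
    qed
  qed
  with strict_mono_o[OF s t] show thesis by (rule that)
qed

text \<open>Constant indices would not do: mass may concentrate on small sets in directions that no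
  fixed \<open>p n\<close> detects in the limit. Letting the index depend on \<omega> is what
  excludes this.\<close>

lemma (in prob_space) L1_tendsto_0_of_random_index:
  fixes w :: "nat \<Rightarrow> 'a \<Rightarrow> 'b::{banach, second_countable_topology}"
  assumes w: "\<And>k. integrable M (w k)" and ae: "AE \<omega> in M. (\<lambda>k. w k \<omega>) \<longlonglongrightarrow> 0"
    and [measurable]: "\<And>n. p n \<in> borel_measurable borel"
    and nonneg: "\<And>n x. 0 \<le> (p n x :: real)" and le: "\<And>n x. p n x \<le> norm x"
    and inc: "\<And>x. incseq (\<lambda>n. p n x)" and lim: "\<And>x. (\<lambda>n. p n x) \<longlonglongrightarrow> norm x"
    and conv: "\<And>N. N \<in> measurable M (count_space UNIV) \<Longrightarrow> (\<lambda>k. \<integral>\<omega>. p (N \<omega>) (w k \<omega>) \<partial>M) \<longlonglongrightarrow> 0"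
  shows "(\<lambda>k. \<integral>\<omega>. norm (w k \<omega>) \<partial>M) \<longlonglongrightarrow> 0"
proof (rule order_tendstoI)
  fix e :: real assume "0 < e"
  \<comment> \<open>One third each for the choice of \<open>n k\<close>, for the points where the
    norm is at most \<delta>, and for the limit of the integrals with index
    \<open>N\<close>.\<close>
  define \<delta> where "\<delta> = e / 3"
  have \<delta>: "0 < \<delta>" using \<open>0 < e\<close> by (simp add: \<delta>_def)
  have [measurable]: "w k \<in> borel_measurable M" for k using w by auto
  have int_p: "integrable M (\<lambda>\<omega>. p n (w k \<omega>))" for n k
    by (rule Bochner_Integration.integrable_bound[OF w[of k]]) (auto simp: nonneg le)
  have "\<exists>n. \<forall>k. (\<integral>\<omega>. norm (w k \<omega>) \<partial>M) - \<delta> < (\<integral>\<omega>. p (n k) (w k \<omega>) \<partial>M)"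
  proof (intro choice allI)
    fix k
    have "(\<lambda>n. \<integral>\<omega>. p n (w k \<omega>) \<partial>M) \<longlonglongrightarrow> (\<integral>\<omega>. norm (w k \<omega>) \<partial>M)"
      by (rule integral_dominated_convergence[where w = "\<lambda>\<omega>. norm (w k \<omega>)"])
        (use w in \<open>auto simp: nonneg le lim\<close>)
    then have "\<forall>\<^sub>F n in sequentially. (\<integral>\<omega>. norm (w k \<omega>) \<partial>M) - \<delta> < (\<integral>\<omega>. p n (w k \<omega>) \<partial>M)"
      using \<delta> by (intro order_tendstoD(1)) auto
    then show "\<exists>n. (\<integral>\<omega>. norm (w k \<omega>) \<partial>M) - \<delta> < (\<integral>\<omega>. p n (w k \<omega>) \<partial>M)"
      by (auto simp: eventually_sequentially)
  qed
  then obtain n where n: "\<And>k. (\<integral>\<omega>. norm (w k \<omega>) \<partial>M) - \<delta> < (\<integral>\<omega>. p (n k) (w k \<omega>) \<partial>M)" by blast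
  \<comment> \<open>Where no \<open>m\<close> is a bound, \<open>LEAST\<close> is unspecified;
    \<open>N_ge\<close> shows that a bound exists almost everywhere.\<close>
  define N where "N \<omega> = (LEAST m. \<forall>k. \<delta> < norm (w k \<omega>) \<longrightarrow> n k \<le> m)" for \<omega>
  have N [measurable]: "N \<in> measurable M (count_space UNIV)" unfolding N_def by measurable
  have int_N: "integrable M (\<lambda>\<omega>. p (N \<omega>) (w k \<omega>))" for k
  proof (rule Bochner_Integration.integrable_bound[OF w[of k]])
    show "(\<lambda>\<omega>. p (N \<omega>) (w k \<omega>)) \<in> borel_measurable M"
      by (rule measurable_compose_countable[OF _ N]) measurable
  qed (simp add: nonneg le)
  have N_ge: "AE \<omega> in M. \<forall>k. \<delta> < norm (w k \<omega>) \<longrightarrow> n k \<le> N \<omega>"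
    using ae
  proof eventually_elim
    case (elim \<omega>)
    obtain k0 where k0: "\<And>k. k0 \<le> k \<Longrightarrow> norm (w k \<omega>) < \<delta>"
      using order_tendstoD(2)[OF tendsto_norm_zero[OF elim] \<delta>] by (auto simp: eventually_sequentially)
    \<comment> \<open>Only indices below \<open>k0\<close> can satisfy the premise, and the sum
      dominates each of their \<open>n i\<close>.\<close>
    have "\<forall>k. \<delta> < norm (w k \<omega>) \<longrightarrow> n k \<le> (\<Sum>i<k0. n i)"
    proof (intro allI impI)
      fix k assume "\<delta> < norm (w k \<omega>)"
      then have "k < k0" using k0[of k] by (meson less_asym not_le)
      then show "n k \<le> (\<Sum>i<k0. n i)" by (intro member_le_sum) auto
    qed
    then show ?case unfolding N_def by (rule LeastI)
  qed
  have "\<forall>\<^sub>F k in sequentially. (\<integral>\<omega>. p (N \<omega>) (w k \<omega>) \<partial>M) < \<delta>"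
    by (rule order_tendstoD(2)[OF conv[OF N] \<delta>])
  then show "\<forall>\<^sub>F k in sequentially. (\<integral>\<omega>. norm (w k \<omega>) \<partial>M) < e"
  proof eventually_elim
    case (elim k)
    have "(\<integral>\<omega>. p (n k) (w k \<omega>) \<partial>M) \<le> (\<integral>\<omega>. p (N \<omega>) (w k \<omega>) + \<delta> \<partial>M)"
    proof (rule integral_mono_AE)
      show "AE \<omega> in M. p (n k) (w k \<omega>) \<le> p (N \<omega>) (w k \<omega>) + \<delta>"
        using N_ge
      proof eventually_elim
        case (elim \<omega>)
        show ?case
        proof (cases "\<delta> < norm (w k \<omega>)")
          case True
          with elim have "p (n k) (w k \<omega>) \<le> p (N \<omega>) (w k \<omega>)" by (intro incseqD[OF inc]) blast
          with \<delta> show ?thesis by simp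
        next
          case False
          with le[of "n k" "w k \<omega>"] nonneg[of "N \<omega>" "w k \<omega>"] show ?thesis by simp
        qed
      qed
    qed (use int_p int_N in auto)
    also have "\<dots> = (\<integral>\<omega>. p (N \<omega>) (w k \<omega>) \<partial>M) + \<delta>" using int_N by (simp add: prob_space)
    finally show ?case using n[of k] elim by (simp add: \<delta>_def)
  qed
next
  fix a :: real assume "a < 0"
  moreover have "0 \<le> (\<integral>\<omega>. norm (w k \<omega>) \<partial>M)" for k by simp
  ultimately show "\<forall>\<^sub>F k in sequentially. a < (\<integral>\<omega>. norm (w k \<omega>) \<partial>M)"
    by (intro always_eventually allI) (rule less_le_trans)
qed

text \<open>A given subsequence \<open>r\<close> is refined twice: along \<open>s\<close> all
  \<open>p n\<close> of the differences tend to \<open>0\<close> almost everywhere, and along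
  \<open>t\<close> tightness gives the same for the norm. The random index then yields convergence
  in mean.\<close>

lemma (in prob_space) tight_L1_limitedly_convergent_imp_strongly_convergent:
  fixes f :: "nat \<Rightarrow> 'a \<Rightarrow> 'b::{banach, second_countable_topology}"
  assumes f: "\<And>k. integrable M (f k)" and f0: "integrable M f0"
    and tight: "tight_L1 M (range f)" and limited: "limitedly_convergent M f f0"
  shows "strongly_convergent M f f0"
  unfolding strongly_convergent_def L1_seminorm_def
proof (rule tendsto_zero_subseqI)
  fix r :: "nat \<Rightarrow> nat" assume r: "strict_mono r"
  obtain p :: "nat \<Rightarrow> 'b \<Rightarrow> real"
    where p_cont: "\<And>n. continuous_map weak_topology euclideanreal (p n)" and p_zero: "\<And>n. p n 0 = 0"
      and p_nonneg: "\<And>n x. 0 \<le> p n x" and p_le: "\<And>n x. p n x \<le> norm x"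
      and p_inc: "\<And>x. incseq (\<lambda>n. p n x)" and p_lim: "\<And>x. (\<lambda>n. p n x) \<longlonglongrightarrow> norm x"
    by (rule weakly_continuous_exhaustion_of_norm) blast
  have p_cont_norm: "continuous_on UNIV (p n)" for n
    by (rule weakly_continuous_imp_continuous[OF p_cont])
  have p_meas [measurable]: "p n \<in> borel_measurable borel" for n
    by (intro borel_measurable_continuous_onI p_cont_norm)
  have conv: "(\<lambda>k. \<integral>\<omega>. p (N \<omega>) (f (q k) \<omega> - f0 \<omega>) \<partial>M) \<longlonglongrightarrow> 0"
    if "N \<in> measurable M (count_space UNIV)" "strict_mono q" for N q
  proof -
    have "(\<lambda>\<omega>. p (N \<omega>)) \<in> limited_integrands M"
      by (rule limited_integrands_variable_index[OF p_cont p_zero p_nonneg p_le that(1)])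
    with limited have "(\<lambda>k. \<integral>\<omega>. p (N \<omega>) (f k \<omega> - f0 \<omega>) \<partial>M) \<longlonglongrightarrow> 0"
      by (auto simp: limitedly_convergent_def)
    from LIMSEQ_subseq_LIMSEQ[OF this that(2)] show ?thesis by (simp add: o_def)
  qed
  have [measurable]: "f k \<in> borel_measurable M" "f0 \<in> borel_measurable M" for k using f f0 by auto
  have int_p: "integrable M (\<lambda>\<omega>. p n (f k \<omega> - f0 \<omega>))" for n k
    by (rule Bochner_Integration.integrable_bound[of M "\<lambda>\<omega>. f k \<omega> - f0 \<omega>"])
      (use f f0 in \<open>auto simp: p_nonneg p_le\<close>)
  \<comment> \<open>Here \<open>conv\<close> is applied with constant indices.\<close>
  obtain s where s: "strict_mono s"
    and ae: "AE \<omega> in M. \<forall>n. (\<lambda>k. p n (f (r (s k)) \<omega> - f0 \<omega>)) \<longlonglongrightarrow> 0"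
    by (rule AE_tendsto_0_diagonal_subseq[where p = p and M = M and u = "\<lambda>k \<omega>. f (r k) \<omega> - f0 \<omega>"])
      (use int_p p_nonneg p_inc conv[OF _ r, of "\<lambda>_. _"] in auto)
  have "tight_L1 M (range (\<lambda>k. f (r (s k))))"
  proof -
    obtain h :: "'a \<Rightarrow> 'b \<Rightarrow> ennreal" where h: "(\<lambda>(\<omega>, x). h \<omega> x) \<in> borel_measurable (M \<Otimes>\<^sub>M borel)"
      "(SUP g\<in>range f. \<integral>\<^sup>+\<omega>. h \<omega> (g \<omega>) \<partial>M) < \<infinity>"
      "\<forall>\<omega>\<in>space M. \<forall>\<beta>::real. compact {x. enn2ereal (h \<omega> x) \<le> ereal \<beta>}"
      using tight unfolding tight_L1_def by blast
    have "(SUP g\<in>range (\<lambda>k. f (r (s k))). \<integral>\<^sup>+\<omega>. h \<omega> (g \<omega>) \<partial>M)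
        \<le> (SUP g\<in>range f. \<integral>\<^sup>+\<omega>. h \<omega> (g \<omega>) \<partial>M)"
      by (intro SUP_subset_mono) auto
    then show ?thesis using h unfolding tight_L1_def by (meson le_less_trans)
  qed
  then have "(\<lambda>k. \<integral>\<omega>. min 1 (norm (f (r (s k)) \<omega> - f0 \<omega>)) \<partial>M) \<longlonglongrightarrow> 0"
    by (intro tight_L1_truncated_integral_tendsto_0[OF _ _ _ p_cont_norm p_lim ae]) auto
  then have "(\<lambda>k. \<integral>\<omega>. norm (min 1 (norm (f (r (s k)) \<omega> - f0 \<omega>))) \<partial>M) \<longlonglongrightarrow> 0" by simp
  from tendsto_L1_AE_subseq[OF _ this] obtain t :: "nat \<Rightarrow> nat" where t: "strict_mono t"
    and ae_min: "AE \<omega> in M. (\<lambda>k. min 1 (norm (f (r (s (t k))) \<omega> - f0 \<omega>))) \<longlonglongrightarrow> 0"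
    by (force intro: integrable_const_bound[of _ 1])
  define q where "q = s \<circ> t"
  have q: "strict_mono q" unfolding q_def by (intro strict_mono_o s t)
  have "(\<lambda>k. \<integral>\<omega>. norm (f (r (q k)) \<omega> - f0 \<omega>) \<partial>M) \<longlonglongrightarrow> 0"
  proof (rule L1_tendsto_0_of_random_index[OF _ _ p_meas p_nonneg p_le p_inc p_lim])
    show "integrable M (\<lambda>\<omega>. f (r (q k)) \<omega> - f0 \<omega>)" for k using f f0 by simp
    show "AE \<omega> in M. (\<lambda>k. f (r (q k)) \<omega> - f0 \<omega>) \<longlonglongrightarrow> 0"
      using ae_min
    proof eventually_elim
      case (elim \<omega>)
      \<comment> \<open>Once the truncated norm is below 1, the truncation has no effect.\<close>
      have "\<forall>\<^sub>F k in sequentially. min 1 (norm (f (r (q k)) \<omega> - f0 \<omega>)) < 1"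
        using order_tendstoD(2)[OF elim, of 1] by (simp add: q_def)
      then have "\<forall>\<^sub>F k in sequentially.
          min 1 (norm (f (r (q k)) \<omega> - f0 \<omega>)) = norm (f (r (q k)) \<omega> - f0 \<omega>)"
        by eventually_elim auto
      from tendsto_cong[OF this] elim show ?case by (simp add: q_def tendsto_norm_zero_iff)
    qed
    show "(\<lambda>k. \<integral>\<omega>. p (N \<omega>) (f (r (q k)) \<omega> - f0 \<omega>) \<partial>M) \<longlonglongrightarrow> 0"
      if "N \<in> measurable M (count_space UNIV)" for N
      using conv[OF that strict_mono_o[OF r q]] by (simp add: o_def)
  qed
  with q show "\<exists>s. strict_mono s \<and> (\<lambda>k. \<integral>\<omega>. norm (f (r (s k)) \<omega> - f0 \<omega>) \<partial>M) \<longlonglongrightarrow> 0" by blast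
qed

theorem theorem4p6:
  fixes M :: "'w measure"
    and f :: "nat \<Rightarrow> 'w \<Rightarrow> 'a::{banach, second_countable_topology}"
    and f0 :: "'w \<Rightarrow> 'a"
  assumes "prob_space M"
    and "\<And>k. f k \<in> L1_space M"
    and "f0 \<in> L1_space M"
  shows "strongly_convergent M f f0 \<longleftrightarrow>
    tight_L1 M (range f) \<and> limitedly_convergent M f f0"
proof -
  interpret prob_space M by (rule assms(1))
  have f: "\<And>k. integrable M (f k)" and f0: "integrable M f0"
    using assms(2,3) by (auto simp: L1_space_def)
  show ?thesis
    using strongly_convergent_imp_tight_L1[of f, OF f f0]
      strongly_convergent_imp_limitedly_convergent[of M f, OF f f0]
      tight_L1_limitedly_convergent_imp_strongly_convergent[of f, OF f f0] by blast
qed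

end
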